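(* Let $\mathcal{H}=(V,\mathcal{E})$ be a hypergraph and let $\mathbf{p}=\{p_v\}_{v\in V}$ be parameters with $p_v\in(0,1)$ for all $v\in V$. For every fractional matching $\phi:\mathcal{E}\rightarrow[0,1]$ of $\mathcal{H}$, \[ \pi(\mathbf{p},\mathcal{H}) \leq \prod_{e\in\mathcal{E}} \left(1-\prod_{v\in e} p_v\right)^{\phi(e)}. \] In particular, if the hypergraph $\mathcal{H}$ is $k$-uniform and $p_v=p$ for all $v\in V$, then \[ \pi(\mathbf{p},\mathcal{H}) \leq \left(1-p^k\right)^{\nu^*(\mathcal{H})}, \] where $\nu^*(\mathcal{H})$ is the fractional matching number of $\mathcal{H}$.
   Context: A hypergraph $\mathcal{H}=(V,\mathcal{E})$ consists of a finite set $V$ (the vertices) and a family $\mathcal{E}$ of subsets of $V$ (the edges). It is $k$-uniform if every edge has cardinality $k$. A subset $V'\subseteq V$ is independent if it does not contain any edge from $\mathcal{E}$ (as a subset). A fractional matching of $\mathcal{H}$ is a function $\phi:\mathcal{E}\to[0,1]$ such that $\sum_{e:\,v\in e}\phi(e)\le 1$ for every $v\in V$. The fractional matching number $\nu^*(\mathcal{H})$ is the maximum of $\sum_{e\in\mathcal{E}}\phi(e)$ over all fractional matchings $\phi$ of $\mathcal{H}$. Given $\mathbf{p}=\{p_v\}_{v\in V}$ with $p_v\in(0,1)$, let $\mathbb{I}$ be the random subset of $V$ formed by including each vertex $v\in V$ in $\mathbb{I}$ with probability $p_v$, independently of the other vertices. Then $\pi(\mathbf{p},\mathcal{H})$ denotes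 the probability that $\mathbb{I}$ is independent in $\mathcal{H}$. *)

theory Defs
  imports "HOL-Probability.Probability" "HOL-Probability.Product_PMF"
begin

definition hypergraph :: "'v set \<Rightarrow> 'v set set \<Rightarrow> bool" where
  "hypergraph V E \<longleftrightarrow> finite V \<and> E \<subseteq> Pow V"

definition uniform_hypergraph :: "nat \<Rightarrow> 'v set \<Rightarrow> 'v set set \<Rightarrow> bool" where
  "uniform_hypergraph k V E \<longleftrightarrow> hypergraph V E \<and> (\<forall>e\<in>E. card e = k)"

definition independent_set :: "'v set \<Rightarrow> 'v set set \<Rightarrow> 'v set \<Rightarrow> bool" where
  "independent_set V E W \<longleftrightarrow> W \<subseteq> V \<and> \<not> (\<exists>e\<in>E. e \<subseteq> W)"

text \<open>Only the values on \<open>E\<close> matter; a fractional matching is arbitrary elsewhere.\<close>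

definition fractional_matching :: "'v set \<Rightarrow> 'v set set \<Rightarrow> ('v set \<Rightarrow> real) \<Rightarrow> bool" where
  "fractional_matching V E \<phi> \<longleftrightarrow>
     (\<forall>e\<in>E. 0 \<le> \<phi> e \<and> \<phi> e \<le> 1) \<and> (\<forall>v\<in>V. (\<Sum>e | e \<in> E \<and> v \<in> e. \<phi> e) \<le> 1)"

text \<open>The maximum exists for every hypergraph; see
  \<open>fractional_matching_number_attained\<close> below.\<close>

definition fractional_matching_number :: "'v set \<Rightarrow> 'v set set \<Rightarrow> real" where
  "fractional_matching_number V E =
     (GREATEST s. \<exists>\<phi>. fractional_matching V E \<phi> \<and> s = (\<Sum>e\<in>E. \<phi> e))"

text \<open>The independent coin flips are made for \<open>v \<in> V\<close> only; \<open>Pi_pmf\<close> assigns the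
  default \<open>False\<close> to every other \<open>v\<close>, so the random set is a subset of \<open>V\<close>.\<close>

definition random_subset :: "'v set \<Rightarrow> ('v \<Rightarrow> real) \<Rightarrow> 'v set pmf" where
  "random_subset V p =
     map_pmf (\<lambda>f. {v \<in> V. f v}) (Pi_pmf V False (\<lambda>v. bernoulli_pmf (p v)))"

definition prob_independent :: "('v \<Rightarrow> real) \<Rightarrow> 'v set \<Rightarrow> 'v set set \<Rightarrow> real" where
  "prob_independent p V E =
     measure_pmf.prob (random_subset V p) {W. independent_set V E W}"

text \<open>Real powers of nonnegative reals with the usual convention that the zeroth power of
  \<open>0\<close> is \<open>1\<close>, whereas \<open>0 powr 0 = 0\<close>. Base \<open>0\<close> arises when the empty set is an edge, and in
  the \<open>k\<close>-uniform case with \<open>k = 0\<close>.\<close>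

definition rpow :: "real \<Rightarrow> real \<Rightarrow> real" where
  "rpow x a = (if a = 0 then 1 else x powr a)"

lemma fractional_matching_number_attained:
  fixes V :: "'v set" and E :: "'v set set"
  assumes "hypergraph V E"
  shows "\<exists>\<phi>. fractional_matching V E \<phi> \<and> (\<Sum>e\<in>E. \<phi> e) = fractional_matching_number V E"
    and "fractional_matching V E \<psi> \<Longrightarrow> (\<Sum>e\<in>E. \<psi> e) \<le> fractional_matching_number V E"
proof -
  define B :: "'v set \<Rightarrow> real set" where "B e = (if e \<in> E then {0..1} else {0})" for e
  define K where "K = PiE UNIV B"
  define M where
    "M = K \<inter> {\<phi>. \<forall>v\<in>V. (\<Sum>e | e \<in> E \<and> v \<in> e. \<phi> e) \<le> 1}"
  have "compactin (product_topology (\<lambda>_. euclidean) UNIV) K"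
    unfolding K_def compactin_PiE by (auto simp: B_def)
  then have K: "compact K"
    by (simp add: euclidean_product_topology)
  have "closed {\<phi> :: 'v set \<Rightarrow> real. (\<Sum>e | e \<in> E \<and> v \<in> e. \<phi> e) \<le> 1}" for v
    by (intro closed_Collect_le continuous_on_sum continuous_on_const) simp_all
  then have "closed {\<phi> :: 'v set \<Rightarrow> real. \<forall>v\<in>V. (\<Sum>e | e \<in> E \<and> v \<in> e. \<phi> e) \<le> 1}"
    by (simp add: Collect_ball_eq closed_INT)
  with K have M: "compact M"
    unfolding M_def by (rule compact_Int_closed)
  have "(\<lambda>_. 0) \<in> M"
    by (auto simp: M_def K_def B_def)
  then have "M \<noteq> {}" by blast
  moreover have "continuous_on M (\<lambda>\<phi>. \<Sum>e\<in>E. \<phi> e)"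
    by (intro continuous_on_sum continuous_on_subset[OF continuous_on_product_coordinates]) simp
  ultimately obtain \<phi> where \<phi>: "\<phi> \<in> M" "\<And>\<psi>. \<psi> \<in> M \<Longrightarrow> (\<Sum>e\<in>E. \<psi> e) \<le> (\<Sum>e\<in>E. \<phi> e)"
    using continuous_attains_sup[OF M] by blast
  have "fractional_matching V E \<phi>"
    using \<phi>(1) by (fastforce simp: M_def K_def B_def fractional_matching_def PiE_iff split: if_splits)
  moreover have le: "(\<Sum>e\<in>E. \<psi> e) \<le> (\<Sum>e\<in>E. \<phi> e)" if "fractional_matching V E \<psi>" for \<psi>
  proof -
    define \<psi>' where "\<psi>' e = (if e \<in> E then \<psi> e else 0)" for e
    have "(\<Sum>e | e \<in> E \<and> v \<in> e. \<psi>' e) = (\<Sum>e | e \<in> E \<and> v \<in> e. \<psi> e)" for v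
      by (rule sum.cong) (auto simp: \<psi>'_def)
    with that have "\<psi>' \<in> M"
      by (auto simp: M_def K_def B_def fractional_matching_def \<psi>'_def)
    from \<phi>(2)[OF this] show ?thesis by (simp add: \<psi>'_def)
  qed
  ultimately have eq: "fractional_matching_number V E = (\<Sum>e\<in>E. \<phi> e)"
    unfolding fractional_matching_number_def by (intro Greatest_equality) auto
  show "\<exists>\<phi>. fractional_matching V E \<phi> \<and> (\<Sum>e\<in>E. \<phi> e) = fractional_matching_number V E"
    using \<open>fractional_matching V E \<phi>\<close> eq by auto
  show "fractional_matching V E \<psi> \<Longrightarrow> (\<Sum>e\<in>E. \<psi> e) \<le> fractional_matching_number V E"
    using le eq by simp
qed

end

theory Submission
  imports Defs
begin

text \<open>
  The bound is proved by revealing the random set one vertex at a time. Condition on whether the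
  vertex \<open>v\<close>, of probability \<open>q\<close>, is selected. If it is not, the edges through \<open>v\<close> can no longer
  be contained in the random set and disappear. If it is, each edge \<open>e\<close> through \<open>v\<close> is contained in
  the random set exactly when \<open>e - {v}\<close> is. By induction on the number of vertices, both conditional
  probabilities are bounded by products of the required form. The edges that avoid \<open>v\<close>
  contribute the same factor to both, so what is left to show is
  \<open>q * (\<Prod>e. rpow (x e) (\<phi> e)) + (1 - q) \<le> (\<Prod>e. rpow (q * x e + (1 - q)) (\<phi> e))\<close>,
  where \<open>e\<close> runs over the edges through \<open>v\<close> and \<open>x e\<close> is the probability that \<open>e - {v}\<close> is not
  contained in the random set; indeed, \<open>q * x e + (1 - q)\<close> is this probability for \<open>e\<close> itself. This
  is Hoelder's inequality on a two-point space (\<open>two_point_hoelder\<close>), and it is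
  here that the weights of the edges through \<open>v\<close> must add up to at most \<open>1\<close>.

  Removing \<open>v\<close> can make two edges equal, and both must keep their weight. The
  induction (\<open>prob_avoid_le\<close>) is therefore carried out for indexed families of sets.

  In the uniform case all the bases agree, so the product over the edges is a single power whose
  exponent is the total weight, and this is the fractional matching number for an optimal matching.
\<close>

section \<open>Powers and weighted means\<close>

lemma rpow_nonneg [simp]: "0 \<le> x \<Longrightarrow> 0 \<le> rpow x a"
  by (simp add: rpow_def)

lemma rpow_one [simp]: "rpow 1 a = 1"
  by (simp add: rpow_def)

lemma rpow_mult: "0 \<le> x \<Longrightarrow> 0 \<le> y \<Longrightarrow> rpow (x * y) a = rpow x a * rpow y a"
  by (simp add: rpow_def powr_mult)

lemma rpow_add: "0 \<le> a \<Longrightarrow> 0 \<le> b \<Longrightarrow> rpow x (a + b) = rpow x a * rpow x b"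
  by (auto simp: rpow_def powr_add)

lemma prod_rpow:
  assumes "\<And>i. i \<in> I \<Longrightarrow> 0 \<le> \<phi> i"
  shows "(\<Prod>i\<in>I. rpow x (\<phi> i)) = rpow x (\<Sum>i\<in>I. \<phi> i)"
  using assms
proof (induction I rule: infinite_finite_induct)
  case (insert i I)
  then show ?case by (simp add: rpow_add sum_nonneg)
qed (simp_all add: rpow_def)

text \<open>
  Weights with sum below \<open>1\<close> are allowed because the missing weight can be given to an extra
  point of value \<open>1\<close>, which does not change the geometric mean. As \<open>ln\<close> is concave, it lies
  below its tangent at the arithmetic mean \<open>S\<close>; averaging this over all points gives the claim.
  If some \<open>z i\<close> with nonzero weight vanishes, so does the left-hand side.
\<close>

lemma rpow_weighted_arith_geom_mean:
  fixes z w :: "'i \<Rightarrow> real"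
  assumes fin: "finite I" and w: "\<And>i. i \<in> I \<Longrightarrow> 0 \<le> w i" and le: "(\<Sum>i\<in>I. w i) \<le> 1"
    and z: "\<And>i. i \<in> I \<Longrightarrow> 0 \<le> z i"
  shows "(\<Prod>i\<in>I. rpow (z i) (w i)) \<le> (\<Sum>i\<in>I. w i * z i) + (1 - (\<Sum>i\<in>I. w i))"
proof (cases "\<exists>i\<in>I. z i = 0 \<and> w i \<noteq> 0")
  case True
  then have "(\<Prod>i\<in>I. rpow (z i) (w i)) = 0"
    using fin by (auto simp: rpow_def prod_zero_iff)
  moreover have "0 \<le> (\<Sum>i\<in>I. w i * z i)"
    by (intro sum_nonneg mult_nonneg_nonneg w z)
  ultimately show ?thesis using le by simp
next
  case False
  define S where "S = (\<Sum>i\<in>I. w i * z i) + (1 - (\<Sum>i\<in>I. w i))"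
  have pos: "0 < S"
  proof (cases "\<exists>i\<in>I. w i \<noteq> 0")
    case True
    then obtain i where i: "i \<in> I" "w i \<noteq> 0" by blast
    with False w[of i] z[of i] have "0 < w i * z i"
      by (metis mult_pos_pos order_le_less)
    then have "0 < (\<Sum>i\<in>I. w i * z i)"
      using fin i(1) w z by (intro sum_pos2[of I i]) auto
    with le show ?thesis by (simp add: S_def)
  qed (simp add: S_def)
  have "(\<Prod>i\<in>I. rpow (z i) (w i)) = (\<Prod>i\<in>I. exp (w i * ln (z i)))"
    using False by (intro prod.cong) (auto simp: rpow_def powr_def)
  also have "\<dots> = exp (\<Sum>i\<in>I. w i * ln (z i))"
    by (simp add: exp_sum fin)
  \<comment> \<open>The tangent line of \<^const>\<open>ln\<close> at \<open>S\<close> lies above its graph.\<close>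
  also have "(\<Sum>i\<in>I. w i * ln (z i)) \<le> (\<Sum>i\<in>I. w i * (ln S + z i / S - 1))"
  proof (rule sum_mono)
    fix i assume i: "i \<in> I"
    show "w i * ln (z i) \<le> w i * (ln S + z i / S - 1)"
    proof (cases "w i = 0")
      case False
      with \<open>\<not> (\<exists>i\<in>I. _ i)\<close> i z have "0 < z i" by (metis order_le_less)
      then have "ln (z i / S) \<le> z i / S - 1"
        using pos by (intro ln_le_minus_one divide_pos_pos)
      then have "ln (z i) \<le> ln S + z i / S - 1"
        using pos \<open>0 < z i\<close> by (subst (asm) ln_div) auto
      then show ?thesis using w[OF i] by (rule mult_left_mono)
    qed simp
  qed
  also have "\<dots> = (\<Sum>i\<in>I. w i) * (ln S - 1) + (\<Sum>i\<in>I. w i * z i) / S"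
    by (simp add: algebra_simps sum.distrib sum_subtractf flip: sum_distrib_left sum_distrib_right sum_divide_distrib)
  also have "\<dots> = ln S - (1 - (\<Sum>i\<in>I. w i)) * (ln S - 1 + 1 / S)"
  proof -
    have "(\<Sum>i\<in>I. w i * z i) / S = 1 - (1 - (\<Sum>i\<in>I. w i)) / S"
      using pos by (simp add: S_def field_simps)
    then show ?thesis by (simp add: algebra_simps diff_divide_distrib)
  qed
  \<comment> \<open>The missing weight sits at the value \<open>1\<close>, where the same tangent line is above \<open>ln 1 = 0\<close>.\<close>
  also have "\<dots> \<le> ln S"
  proof -
    have "ln (1 / S) \<le> 1 / S - 1"
      using pos by (intro ln_le_minus_one) simp
    then have "0 \<le> ln S - 1 + 1 / S"
      using pos by (simp add: ln_div)
    then show ?thesis using le by simp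
  qed
  finally show ?thesis using pos by (simp add: S_def)
qed

text \<open>
  Hoelder's inequality on a space with two points of masses \<open>q\<close> and \<open>1 - q\<close>, where the \<open>i\<close>-th
  function, before it is raised to the power \<open>w i\<close>, has the values \<open>x i\<close> and \<open>1\<close>. After
  dividing each function by its mean \<open>y i\<close>, the arithmetic-geometric mean inequality at each
  of the two points bounds the product of the powers by a weighted sum that has mean exactly \<open>1\<close>.
\<close>

lemma two_point_hoelder:
  fixes x w :: "'i \<Rightarrow> real"
  assumes fin: "finite I" and w: "\<And>i. i \<in> I \<Longrightarrow> 0 \<le> w i" and le: "(\<Sum>i\<in>I. w i) \<le> 1"
    and x: "\<And>i. i \<in> I \<Longrightarrow> 0 \<le> x i" and q: "0 \<le> q" "q < 1"
  shows "q * (\<Prod>i\<in>I. rpow (x i) (w i)) + (1 - q) \<le> (\<Prod>i\<in>I. rpow (q * x i + (1 - q)) (w i))"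
proof -
  define y where "y i = q * x i + (1 - q)" for i
  have y: "0 < y i" if "i \<in> I" for i
    using x[OF that] q by (simp add: y_def add_nonneg_pos)
  define Y where "Y = (\<Prod>i\<in>I. rpow (y i) (w i))"
  have Y: "0 < Y"
    unfolding Y_def using y by (intro prod_pos) (force simp: rpow_def)
  have split: "(\<Prod>i\<in>I. rpow (u i) (w i)) = Y * (\<Prod>i\<in>I. rpow (u i / y i) (w i))"
    if "\<And>i. i \<in> I \<Longrightarrow> 0 \<le> u i" for u
  proof -
    have "rpow (u i) (w i) = rpow (y i) (w i) * rpow (u i / y i) (w i)" if "i \<in> I" for i
      using y[OF that] \<open>\<And>i. i \<in> I \<Longrightarrow> 0 \<le> u i\<close>[OF that] by (simp flip: rpow_mult)
    then show ?thesis by (simp add: Y_def prod.distrib)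
  qed
  let ?G = "\<lambda>u. \<Prod>i\<in>I. rpow (u i / y i) (w i)"
  let ?A = "\<lambda>u. (\<Sum>i\<in>I. w i * (u i / y i)) + (1 - (\<Sum>i\<in>I. w i))"
  have amgm: "?G u \<le> ?A u" if "\<And>i. i \<in> I \<Longrightarrow> 0 \<le> u i" for u
    using y that by (intro rpow_weighted_arith_geom_mean fin w le) (auto intro!: divide_nonneg_pos)
  have "q * (\<Prod>i\<in>I. rpow (x i) (w i)) + (1 - q) = Y * (q * ?G x + (1 - q) * ?G (\<lambda>_. 1))"
    using split[of x] split[of "\<lambda>_. 1"] x by (simp add: algebra_simps)
  also have "\<dots> \<le> Y * (q * ?A x + (1 - q) * ?A (\<lambda>_. 1))"
    using Y q x by (intro mult_left_mono add_mono amgm) auto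
  also have "q * ?A x + (1 - q) * ?A (\<lambda>_. 1)
      = (\<Sum>i\<in>I. q * (w i * (x i / y i)) + (1 - q) * (w i * (1 / y i))) + (1 - (\<Sum>i\<in>I. w i))"
    unfolding sum.distrib sum_distrib_left[symmetric] by algebra
  also have "(\<Sum>i\<in>I. q * (w i * (x i / y i)) + (1 - q) * (w i * (1 / y i))) = (\<Sum>i\<in>I. w i)"
  proof (rule sum.cong[OF refl])
    fix i assume "i \<in> I"
    then have "y i \<noteq> 0" using y by force
    have "q * (w i * (x i / y i)) + (1 - q) * (w i * (1 / y i)) = w i * ((q * x i + (1 - q)) / y i)"
      by (simp add: add_divide_distrib diff_divide_distrib algebra_simps)
    also have "\<dots> = w i * (y i / y i)"
      by (simp add: y_def)
    finally have "q * (w i * (x i / y i)) + (1 - q) * (w i * (1 / y i)) = w i * (y i / y i)" .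
    with \<open>y i \<noteq> 0\<close> show "q * (w i * (x i / y i)) + (1 - q) * (w i * (1 / y i)) = w i"
      by simp
  qed
  finally show ?thesis by (simp add: Y_def y_def)
qed

section \<open>Random subsets, one vertex at a time\<close>

text \<open>The coin of \<open>v\<close> can be tossed first, which makes it possible to condition on it.\<close>

lemma random_subset_insert:
  assumes "finite V" "v \<notin> V"
  shows "random_subset (insert v V) p =
    bernoulli_pmf (p v) \<bind> (\<lambda>b. map_pmf (\<lambda>W. if b then insert v W else W) (random_subset V p))"
proof -
  have "{u \<in> insert v V. (f(v := b)) u} =
      (if b then insert v {u \<in> V. f u} else {u \<in> V. f u})" for f b
    using assms by auto
  then show ?thesis
    using assms unfolding random_subset_def
    by (simp add: Pi_pmf_insert' map_bind_pmf map_pmf_def bind_assoc_pmf bind_return_pmf)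
qed

lemma prob_random_subset_insert:
  assumes "finite V" "v \<notin> V" and q: "0 \<le> p v" "p v \<le> 1"
  shows "measure_pmf.prob (random_subset (insert v V) p) {W. P W} =
    p v * measure_pmf.prob (random_subset V p) {W. P (insert v W)} +
    (1 - p v) * measure_pmf.prob (random_subset V p) {W. P W}"
proof -
  let ?R = "random_subset V p"
  have "ennreal (measure_pmf.prob (random_subset (insert v V) p) {W. P W}) =
    ennreal (p v * measure_pmf.prob ?R {W. P (insert v W)} + (1 - p v) * measure_pmf.prob ?R {W. P W})"
    using q by (simp add: random_subset_insert assms emeasure_bind_pmf vimage_def mult.commute
        ennreal_mult ennreal_plus flip: measure_pmf.emeasure_eq_measure)
  then show ?thesis using q by (subst (asm) ennreal_inj) auto
qed

text \<open>
  Induction on \<open>V\<close>. Once no vertices are left, only empty sets remain, and a single one of them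
  makes the event impossible. In the step, \<open>J\<close> collects the indices of the sets through the new
  vertex and \<open>K\<close> the others: if the vertex is selected, the sets of \<open>J\<close> lose it, and if it is not,
  they can be dropped.
\<close>

lemma prob_avoid_le:
  fixes A :: "'i \<Rightarrow> 'v set" and w :: "'i \<Rightarrow> real" and p :: "'v \<Rightarrow> real"
  assumes "finite V" "finite I"
    and "\<And>i. i \<in> I \<Longrightarrow> A i \<subseteq> V"
    and "\<And>i. i \<in> I \<Longrightarrow> 0 \<le> w i"
    and "\<And>v. v \<in> V \<Longrightarrow> (\<Sum>i | i \<in> I \<and> v \<in> A i. w i) \<le> 1"
    and "\<And>v. v \<in> V \<Longrightarrow> 0 \<le> p v \<and> p v < 1"
  shows "measure_pmf.prob (random_subset V p) {W. \<forall>i\<in>I. \<not> A i \<subseteq> W}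
    \<le> (\<Prod>i\<in>I. rpow (1 - (\<Prod>v\<in>A i. p v)) (w i))"
  using assms
proof (induction V arbitrary: I A rule: finite_induct)
  case empty
  show ?case
  proof (cases "I = {}")
    case False
    then have "{W. \<forall>i\<in>I. \<not> A i \<subseteq> W} = {}" using empty by auto
    then show ?thesis using empty by (auto intro!: prod_nonneg)
  qed simp
next
  case (insert v V)
  let ?R = "random_subset V p"
  let ?f = "\<lambda>B. 1 - (\<Prod>u\<in>B. p u)"
  define J where "J = {i \<in> I. v \<in> A i}"
  define K where "K = {i \<in> I. v \<notin> A i}"
  have IJK: "I = J \<union> K" "J \<inter> K = {}" "finite J" "finite K"
    using \<open>finite I\<close> by (auto simp: J_def K_def)
  have p: "0 \<le> p u" "p u < 1" if "u \<in> insert v V" for u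
    using insert.prems(5) that by auto
  have finA: "finite (A i)" if "i \<in> I" for i
    using insert.prems(2)[OF that] insert.hyps(1) by (meson finite.insertI finite_subset)
  have f_nonneg: "0 \<le> ?f B" if "B \<subseteq> insert v V" for B
  proof -
    have "(\<Prod>u\<in>B. p u) \<le> 1" using p that by (intro prod_le_1) (auto simp: less_imp_le)
    then show ?thesis by simp
  qed
  have "measure_pmf.prob ?R {W. \<forall>i\<in>I. \<not> A i \<subseteq> insert v W} =
      measure_pmf.prob ?R {W. \<forall>i\<in>I. \<not> A i - {v} \<subseteq> W}"
    by (simp add: subset_insert_iff Diff_subset_conv)
  also have "\<dots> \<le> (\<Prod>i\<in>I. rpow (?f (A i - {v})) (w i))"
  proof (rule insert.IH)
    fix u assume "u \<in> V"
    then have "u \<noteq> v" using insert.hyps by auto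
    with insert.prems(4)[of u] \<open>u \<in> V\<close> show "(\<Sum>i | i \<in> I \<and> u \<in> A i - {v}. w i) \<le> 1"
      by simp
  qed (use insert.prems in auto)
  also have "\<dots> = (\<Prod>i\<in>J. rpow (?f (A i - {v})) (w i)) * (\<Prod>i\<in>K. rpow (?f (A i)) (w i))"
  proof -
    have "(\<Prod>i\<in>K. rpow (?f (A i - {v})) (w i)) = (\<Prod>i\<in>K. rpow (?f (A i)) (w i))"
      by (intro prod.cong) (auto simp: K_def)
    then show ?thesis using IJK(2-4) by (simp add: IJK(1) prod.union_disjoint)
  qed
  finally have 1: "measure_pmf.prob ?R {W. \<forall>i\<in>I. \<not> A i \<subseteq> insert v W} \<le> \<dots>" .
  have "measure_pmf.prob ?R {W. \<forall>i\<in>I. \<not> A i \<subseteq> W} \<le> measure_pmf.prob ?R {W. \<forall>i\<in>K. \<not> A i \<subseteq> W}"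
    by (intro measure_pmf.finite_measure_mono) (auto simp: K_def)
  also have "\<dots> \<le> (\<Prod>i\<in>K. rpow (?f (A i)) (w i))"
  proof (rule insert.IH)
    fix u assume "u \<in> V"
    have "(\<Sum>i | i \<in> K \<and> u \<in> A i. w i) \<le> (\<Sum>i | i \<in> I \<and> u \<in> A i. w i)"
      using insert.prems by (intro sum_mono2) (auto simp: K_def)
    also have "\<dots> \<le> 1" using insert.prems(4) \<open>u \<in> V\<close> by simp
    finally show "(\<Sum>i | i \<in> K \<and> u \<in> A i. w i) \<le> 1" .
  qed (use insert.prems in \<open>auto simp: K_def\<close>)
  finally have 2: "measure_pmf.prob ?R {W. \<forall>i\<in>I. \<not> A i \<subseteq> W} \<le> \<dots>" .
  have "measure_pmf.prob (random_subset (insert v V) p) {W. \<forall>i\<in>I. \<not> A i \<subseteq> W} =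
      p v * measure_pmf.prob ?R {W. \<forall>i\<in>I. \<not> A i \<subseteq> insert v W} +
      (1 - p v) * measure_pmf.prob ?R {W. \<forall>i\<in>I. \<not> A i \<subseteq> W}"
    using insert.hyps p[of v] by (intro prob_random_subset_insert) auto
  also have "\<dots> \<le> p v * ((\<Prod>i\<in>J. rpow (?f (A i - {v})) (w i)) * (\<Prod>i\<in>K. rpow (?f (A i)) (w i))) +
      (1 - p v) * (\<Prod>i\<in>K. rpow (?f (A i)) (w i))"
    using p[of v] by (intro add_mono mult_left_mono 1 2) auto
  also have "\<dots> = (p v * (\<Prod>i\<in>J. rpow (?f (A i - {v})) (w i)) + (1 - p v)) *
      (\<Prod>i\<in>K. rpow (?f (A i)) (w i))"
    by (simp add: algebra_simps)
  also have "\<dots> \<le> (\<Prod>i\<in>J. rpow (p v * ?f (A i - {v}) + (1 - p v)) (w i)) *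
      (\<Prod>i\<in>K. rpow (?f (A i)) (w i))"
  proof (rule mult_right_mono[OF two_point_hoelder])
    show "(\<Sum>i\<in>J. w i) \<le> 1" using insert.prems(4)[of v] by (simp add: J_def)
    show "0 \<le> ?f (A i - {v})" if "i \<in> J" for i
      using insert.prems(2)[of i] that by (intro f_nonneg) (auto simp: J_def)
    show "0 \<le> (\<Prod>i\<in>K. rpow (?f (A i)) (w i))"
      using insert.prems(2) by (intro prod_nonneg rpow_nonneg f_nonneg) (simp add: K_def)
    show "0 \<le> w i" if "i \<in> J" for i
      using insert.prems(3) that by (simp add: J_def)
  qed (use IJK(3) p[of v] in auto)
  also have "(\<Prod>i\<in>J. rpow (p v * ?f (A i - {v}) + (1 - p v)) (w i)) = (\<Prod>i\<in>J. rpow (?f (A i)) (w i))"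
  proof (intro prod.cong refl)
    fix i assume "i \<in> J"
    then have "(\<Prod>u\<in>A i. p u) = p v * (\<Prod>u\<in>A i - {v}. p u)"
      using finA by (intro prod.remove) (auto simp: J_def)
    then show "rpow (p v * ?f (A i - {v}) + (1 - p v)) (w i) = rpow (?f (A i)) (w i)"
      by (simp add: algebra_simps)
  qed
  also have "\<dots> * (\<Prod>i\<in>K. rpow (?f (A i)) (w i)) = (\<Prod>i\<in>I. rpow (?f (A i)) (w i))"
    using IJK(2-4) by (simp add: IJK(1) prod.union_disjoint)
  finally show ?case .
qed

section \<open>Independent sets and fractional matchings\<close>

theorem theorem2p6:
  fixes V :: "'v set" and E :: "'v set set" and p :: "'v \<Rightarrow> real"
  assumes "hypergraph V E"
    and "\<forall>v\<in>V. 0 < p v \<and> p v < 1"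
  shows "(\<forall>\<phi>. fractional_matching V E \<phi> \<longrightarrow>
           prob_independent p V E \<le> (\<Prod>e\<in>E. rpow (1 - (\<Prod>v\<in>e. p v)) (\<phi> e))) \<and>
         (\<forall>k q. uniform_hypergraph k V E \<and> (\<forall>v\<in>V. p v = q) \<longrightarrow>
           prob_independent p V E \<le> rpow (1 - q ^ k) (fractional_matching_number V E))"
proof -
  have V: "finite V" and E: "E \<subseteq> Pow V"
    using assms(1) by (auto simp: hypergraph_def)
  then have finE: "finite E" by (meson finite_Pow_iff finite_subset)
  have bound: "prob_independent p V E \<le> (\<Prod>e\<in>E. rpow (1 - (\<Prod>v\<in>e. p v)) (\<phi> e))"
    if "fractional_matching V E \<phi>" for \<phi>
  proof -
    have "prob_independent p V E \<le> measure_pmf.prob (random_subset V p) {W. \<forall>e\<in>E. \<not> e \<subseteq> W}"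
      unfolding prob_independent_def
      by (intro measure_pmf.finite_measure_mono) (auto simp: independent_set_def)
    also have "\<dots> \<le> (\<Prod>e\<in>E. rpow (1 - (\<Prod>v\<in>e. p v)) (\<phi> e))"
      using that V E finE assms(2)
      by (intro prob_avoid_le[where A = "\<lambda>e. e"]) (auto simp: fractional_matching_def less_imp_le)
    finally show ?thesis .
  qed
  moreover have "prob_independent p V E \<le> rpow (1 - q ^ k) (fractional_matching_number V E)"
    if unif: "uniform_hypergraph k V E" and q: "\<forall>v\<in>V. p v = q" for k q
  proof -
    obtain \<phi> where \<phi>: "fractional_matching V E \<phi>" "(\<Sum>e\<in>E. \<phi> e) = fractional_matching_number V E"
      using fractional_matching_number_attained(1)[OF assms(1)] by auto
    have "(\<Prod>v\<in>e. p v) = q ^ k" if "e \<in> E" for e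
    proof -
      have "(\<Prod>v\<in>e. p v) = (\<Prod>v\<in>e. q)"
        using q E that by (intro prod.cong) auto
      then show ?thesis using unif that by (simp add: uniform_hypergraph_def)
    qed
    then have "(\<Prod>e\<in>E. rpow (1 - (\<Prod>v\<in>e. p v)) (\<phi> e)) = (\<Prod>e\<in>E. rpow (1 - q ^ k) (\<phi> e))"
      by simp
    also have "\<dots> = rpow (1 - q ^ k) (\<Sum>e\<in>E. \<phi> e)"
      using \<phi>(1) by (intro prod_rpow) (auto simp: fractional_matching_def)
    finally show ?thesis using bound[OF \<phi>(1)] \<phi>(2) by simp
  qed
  ultimately show ?thesis by blast
qed

end
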